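(* Fix integers $h,k>0$ and a nonempty partition $\mu$ with $h\ge h_\mu$. Then $$F_{\mu,k}(q)=\frac{1}{(1-q)(1-q^2)\cdots(1-q^{k+w_\mu})}\sum_{(\mu,\lambda,\theta)\in\mathcal{A}(\mu,h,k)}(-1)^{w_\lambda}q^{|(\mu,\lambda,\theta)|}.$$
   Context: A partition is a weakly decreasing sequence $\mu=(\mu_1,\mu_2,\ldots)$ of nonnegative integers with finitely many positive terms, identified with its Ferrers board; weight $|\mu|=\sum\mu_i$, height $h_\mu$ = number of positive parts, width $w_\mu=\mu_1$; $\mu$ is nonempty if $\mu_1>0$. The conjugate $\lambda^*$ has $\lambda^*_i=|\{j:\lambda_j\ge i\}|$, the length of the $i$-th column. A partition $\alpha$ contains $\mu$ if deleting some rows and some columns of the Ferrers board of $\alpha$ yields that of $\mu$. $\mathcal{P}_n(\mu,k)$ is the set of partitions of weight $n$ and width $w_\mu+k$ containing $\mu$, and $F_{\mu,k}(q)=\sum_{n\ge0}|\mathcal{P}_n(\mu,k)|q^n$. A $(\mu,h,k)$-augmented structure is a triple $(\mu,\lambda,\theta)$ of partitions with $h_\lambda\le h$, $h_\theta\le h+w_\lambda$, $w_\lambda+w_\theta=k$, and every column of $\lambda$ of length at least $2$ (i.e. $\lambda^*_i\ge2$ for $1\le i\le w_\lambda$); either of $\lambda,\theta$ may be empty. $\mathcal{A}(\mu,h,k)$ is the set of these. Its weight is $|(\mu,\lambda,\theta)|=|\mu|+|\lambda|+|\theta|+\frac{a(a-1)}{2}+\sum_{i=1}^{a}\mu_{\lambda^*_i}$,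 where $a=w_\lambda$. *)

theory Defs
  imports "HOL-Computational_Algebra.Formal_Power_Series"
begin

text \<open>
  Partitions are sequences of type \<^typ>\<open>nat \<Rightarrow> nat\<close> indexed from 0: the part usually written
  \<open>\<mu>\<^sub>i\<close> with \<open>i \<ge> 1\<close> is \<open>\<mu> (i - 1)\<close>. Rows and columns of the Ferrers board are also
  numbered from 0.
\<close>

definition is_partition :: "(nat \<Rightarrow> nat) \<Rightarrow> bool" where
  "is_partition \<mu> \<longleftrightarrow> antimono \<mu> \<and> finite {i. \<mu> i > 0}"

definition weight :: "(nat \<Rightarrow> nat) \<Rightarrow> nat" where
  "weight \<mu> = (\<Sum>i | \<mu> i > 0. \<mu> i)"

definition height :: "(nat \<Rightarrow> nat) \<Rightarrow> nat" where
  "height \<mu> = card {i. \<mu> i > 0}"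

definition width :: "(nat \<Rightarrow> nat) \<Rightarrow> nat" where
  "width \<mu> = \<mu> 0"

definition board :: "(nat \<Rightarrow> nat) \<Rightarrow> (nat \<times> nat) set" where
  "board \<mu> = {(i, j). j < \<mu> i}"

text \<open>\<open>conj_part \<mu> j\<close> is the length of column \<open>j\<close>, i.e. \<open>\<mu>\<^sup>*\<close> at the 1-based index \<open>j + 1\<close>.\<close>

definition conj_part :: "(nat \<Rightarrow> nat) \<Rightarrow> nat \<Rightarrow> nat" where
  "conj_part \<mu> j = card {i. \<mu> i \<ge> j + 1}"

text \<open>
  Deleting the rows in \<open>R\<close> and the columns in \<open>C\<close> moves each remaining row (column) up (left)
  by the number of deleted rows (columns) before it.
\<close>

definition delete_lines :: "nat set \<Rightarrow> nat set \<Rightarrow> (nat \<times> nat) set \<Rightarrow> (nat \<times> nat) set" where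
  "delete_lines R C B =
     (\<lambda>(i, j). (card {i'. i' < i \<and> i' \<notin> R}, card {j'. j' < j \<and> j' \<notin> C})) `
       {(i, j) \<in> B. i \<notin> R \<and> j \<notin> C}"

definition contains :: "(nat \<Rightarrow> nat) \<Rightarrow> (nat \<Rightarrow> nat) \<Rightarrow> bool" where
  "contains \<alpha> \<mu> \<longleftrightarrow>
     (\<exists>R C. R \<subseteq> {..<height \<alpha>} \<and> C \<subseteq> {..<width \<alpha>} \<and>
        delete_lines R C (board \<alpha>) = board \<mu>)"

definition partitions_containing :: "nat \<Rightarrow> (nat \<Rightarrow> nat) \<Rightarrow> nat \<Rightarrow> (nat \<Rightarrow> nat) set" where
  "partitions_containing n \<mu> k =
     {\<alpha>. is_partition \<alpha> \<and> weight \<alpha> = n \<and> width \<alpha> = width \<mu> + k \<and> contains \<alpha> \<mu>}"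

definition gen_fun :: "(nat \<Rightarrow> nat) \<Rightarrow> nat \<Rightarrow> rat fps" where
  "gen_fun \<mu> k = Abs_fps (\<lambda>n. of_nat (card (partitions_containing n \<mu> k)))"

type_synonym structure3 = "(nat \<Rightarrow> nat) \<times> (nat \<Rightarrow> nat) \<times> (nat \<Rightarrow> nat)"

definition augmented_structures :: "(nat \<Rightarrow> nat) \<Rightarrow> nat \<Rightarrow> nat \<Rightarrow> structure3 set" where
  "augmented_structures \<mu> h k =
     {(\<mu>', lam, \<theta>). \<mu>' = \<mu> \<and> is_partition \<mu> \<and> is_partition lam \<and> is_partition \<theta> \<and>
        height lam \<le> h \<and> height \<theta> \<le> h + width lam \<and> width lam + width \<theta> = k \<and>
        (\<forall>j < width lam. conj_part lam j \<ge> 2)}"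

text \<open>
  In the last sum, \<open>conj_part lam j - 1\<close> is the 0-based index of the part of \<open>\<mu>\<close> whose 1-based
  index is \<open>conj_part lam j\<close>; column lengths are positive for \<open>j < width lam\<close>.
\<close>

fun structure_weight :: "structure3 \<Rightarrow> nat" where
  "structure_weight (\<mu>, lam, \<theta>) =
     weight \<mu> + weight lam + weight \<theta> + width lam * (width lam - 1) div 2 +
     (\<Sum>j < width lam. \<mu> (conj_part lam j - 1))"

text \<open>
  The cardinalities and the sum over augmented structures range over finite sets, so the
  conventions for infinite sets never apply.
\<close>

lemma part_zero_beyond_height:
  assumes "is_partition \<mu>" "height \<mu> \<le> i"
  shows "\<mu> i = 0"
proof (rule ccontr)
  assume "\<mu> i \<noteq> 0"
  have "\<mu> j > 0" if "j \<le> i" for j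
    using assms(1) \<open>\<mu> i \<noteq> 0\<close> that unfolding is_partition_def
    by (metis antimonoD bot_nat_0.extremum_uniqueI neq0_conv)
  then have "{..i} \<subseteq> {j. \<mu> j > 0}" by auto
  then have "card {..i} \<le> height \<mu>"
    using assms(1) unfolding height_def is_partition_def by (intro card_mono) auto
  with assms(2) show False by simp
qed

lemma finite_bounded_partitions:
  "finite {\<mu>. is_partition \<mu> \<and> height \<mu> \<le> h \<and> width \<mu> \<le> w}"
proof (rule finite_subset)
  show "{\<mu>. is_partition \<mu> \<and> height \<mu> \<le> h \<and> width \<mu> \<le> w} \<subseteq>
      {f. \<forall>i. (i \<in> {..<h} \<longrightarrow> f i \<in> {..w}) \<and> (i \<notin> {..<h} \<longrightarrow> f i = 0)}"
  proof clarify
    fix \<mu> i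
    assume *: "is_partition \<mu>" "height \<mu> \<le> h" "width \<mu> \<le> w"
    have "\<mu> i \<le> \<mu> 0" using *(1) unfolding is_partition_def by (simp add: antimonoD)
    then show "(i \<in> {..<h} \<longrightarrow> \<mu> i \<in> {..w}) \<and> (i \<notin> {..<h} \<longrightarrow> \<mu> i = 0)"
      using * part_zero_beyond_height[of \<mu> i] by (auto simp: width_def)
  qed
  show "finite {f. \<forall>i. (i \<in> {..<h} \<longrightarrow> f i \<in> {..w}) \<and> (i \<notin> {..<h} \<longrightarrow> f i = (0::nat))}"
    by (rule finite_set_of_finite_funs) auto
qed

lemma height_le_weight: "height \<mu> \<le> weight \<mu>"
proof -
  have "(\<Sum>i | \<mu> i > 0. 1) \<le> (\<Sum>i | \<mu> i > 0. \<mu> i)" by (rule sum_mono) auto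
  then show ?thesis by (simp add: height_def weight_def)
qed

lemma finite_partitions_containing: "finite (partitions_containing n \<mu> k)"
  by (rule finite_subset[OF _ finite_bounded_partitions[of n "width \<mu> + k"]])
    (auto simp: partitions_containing_def intro: height_le_weight)

lemma finite_augmented_structures: "finite (augmented_structures \<mu> h k)"
  by (rule finite_subset[of _ "{\<mu>} \<times> {\<mu>. is_partition \<mu> \<and> height \<mu> \<le> h \<and> width \<mu> \<le> k} \<times>
      {\<mu>. is_partition \<mu> \<and> height \<mu> \<le> h + k \<and> width \<mu> \<le> k}"])
    (auto simp: augmented_structures_def intro: finite_bounded_partitions)

end

theory Submission
  imports Defs "HOL-Library.Infinite_Set"
begin

text \<open>
  Comparing the first row of \<open>\<alpha>\<close> with the number \<open>n\<close> of available columns, and the first row of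
  \<open>\<mu>\<close> with the number \<open>w\<close> of columns to be kept, always lets one delete a row or a column without
  changing whether \<open>\<alpha>\<close> contains \<open>\<mu>\<close>. If \<open>T \<mu> w n\<close> is the generating function of the \<open>\<alpha>\<close> of
  width at most \<open>n\<close> and \<open>\<nu>\<close> is \<open>\<mu>\<close> without its first row, then
  \<open>T \<mu> w n = q ^ n * T \<nu> w n + T \<mu> w (n - 1)\<close> if \<open>\<mu> 0 = w\<close>, and
  \<open>(1 - q ^ n) * T \<mu> w n = T \<mu> (w - 1) (n - 1)\<close> if \<open>\<mu> 0 < w\<close>.
  Summing over \<open>\<theta>\<close> gives Gaussian binomial coefficients and summing over \<open>\<lambda>\<close> gives complete
  homogeneous symmetric polynomials; their Pascal recurrences show that the signed sum satisfies
  the same two recurrences, up to the factor \<open>(1 - q) \<dots> (1 - q ^ n)\<close>. Width exactly \<open>n\<close> reduces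
  to width at most \<open>n\<close> by removing the first row of \<open>\<alpha>\<close> and of \<open>\<mu>\<close>; this matches the condition
  that the columns of \<open>\<lambda>\<close> have length at least 2, i.e. that its first two rows are equal.
\<close>

section \<open>Partitions as sequences; \<open>case_nat a \<alpha>\<close> puts a row of length
  \<open>a\<close> on top of \<open>\<alpha>\<close>\<close>

lemma is_partition_zero [simp]: "is_partition (\<lambda>_. 0)"
  by (simp add: is_partition_def antimono_def)

lemma is_partition_le: "is_partition \<alpha> \<Longrightarrow> i \<le> j \<Longrightarrow> \<alpha> j \<le> \<alpha> i"
  by (simp add: is_partition_def antimonoD)

lemma partition_eq_zero: "is_partition \<alpha> \<Longrightarrow> \<alpha> 0 = 0 \<Longrightarrow> \<alpha> = (\<lambda>_. 0)"
  using is_partition_le[of \<alpha> 0] by (metis ext bot_nat_0.extremum le_zero_eq)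

lemma case_nat_shift: "case_nat (\<alpha> 0) (\<lambda>i. \<alpha> (Suc i)) = \<alpha>"
  by (auto split: nat.split)

lemma case_nat_inject [simp]: "case_nat a f = case_nat b g \<longleftrightarrow> a = b \<and> f = g"
  unfolding fun_eq_iff by (auto split: nat.split)

lemma inj_case_nat: "inj_on (case_nat a) A"
  by (simp add: inj_on_def)

lemma support_case_nat:
  "{i. case_nat a \<alpha> i > (0::nat)} = (if a > 0 then {0} else {}) \<union> Suc ` {i. \<alpha> i > 0}"
proof (rule set_eqI)
  show "i \<in> {i. case_nat a \<alpha> i > (0::nat)} \<longleftrightarrow> i \<in> (if a > 0 then {0} else {}) \<union> Suc ` {i. \<alpha> i > 0}" for i
    by (cases i) auto
qed

lemma is_partition_case_nat [simp]:
  "is_partition (case_nat a \<alpha>) \<longleftrightarrow> is_partition \<alpha> \<and> \<alpha> 0 \<le> a"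
proof -
  have "antimono (case_nat a \<alpha>) \<longleftrightarrow> antimono \<alpha> \<and> \<alpha> 0 \<le> a"
    unfolding antimono_iff_le_Suc by (auto split: nat.splits)
  then show ?thesis
    by (auto simp: is_partition_def support_case_nat finite_image_iff)
qed

lemma is_partition_shift: "is_partition \<alpha> \<Longrightarrow> is_partition (\<lambda>i. \<alpha> (Suc i))"
  by (metis case_nat_shift is_partition_case_nat)

lemma weight_zero [simp]: "weight (\<lambda>_. 0) = 0"
  by (simp add: weight_def)

lemma weight_case_nat:
  assumes "is_partition \<alpha>"
  shows "weight (case_nat a \<alpha>) = a + weight \<alpha>"
proof -
  have "finite {i. \<alpha> i > 0}" using assms by (simp add: is_partition_def)
  then show ?thesis
    by (subst weight_def, subst support_case_nat, subst sum.union_disjoint)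
      (auto simp: sum.reindex weight_def)
qed

lemma weight_shift: "is_partition \<alpha> \<Longrightarrow> weight \<alpha> = \<alpha> 0 + weight (\<lambda>i. \<alpha> (Suc i))"
  by (metis case_nat_shift is_partition_shift weight_case_nat)

lemma height_le_iff:
  assumes "is_partition \<alpha>"
  shows "height \<alpha> \<le> m \<longleftrightarrow> \<alpha> m = 0"
proof
  show "\<alpha> m = 0" if "height \<alpha> \<le> m"
    using part_zero_beyond_height[OF assms that] .
  assume "\<alpha> m = 0"
  then have "{i. \<alpha> i > 0} \<subseteq> {..<m}"
    using is_partition_le[OF assms, of m] by (force simp: not_less[symmetric])
  then have "card {i. \<alpha> i > 0} \<le> card {..<m}" by (intro card_mono) auto
  then show "height \<alpha> \<le> m" by (simp add: height_def)
qed

lemma finite_column: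
  assumes "is_partition \<alpha>"
  shows "finite {i. \<alpha> i \<ge> j + 1}"
  using assms by (auto simp: is_partition_def elim: rev_finite_subset)

lemma conj_part_pos_iff:
  assumes "is_partition \<alpha>"
  shows "conj_part \<alpha> j > 0 \<longleftrightarrow> j < \<alpha> 0"
  using finite_column[OF assms, of j] is_partition_le[OF assms, of 0]
  unfolding conj_part_def card_gt_0_iff by (force simp: Suc_le_eq dest: less_le_trans)

lemma conj_part_case_nat:
  assumes "is_partition \<alpha>" "j < a"
  shows "conj_part (case_nat a \<alpha>) j = Suc (conj_part \<alpha> j)"
proof -
  have "{i. case_nat a \<alpha> i \<ge> j + 1} = insert 0 (Suc ` {i. \<alpha> i \<ge> j + 1})"
    using assms(2) by (auto simp: image_iff split: nat.splits) (metis not0_implies_Suc)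
  then show ?thesis
    using finite_column[OF assms(1), of j] by (simp add: conj_part_def card_image)
qed

section \<open>Partitions in a box\<close>

definition box_partitions :: "nat \<Rightarrow> nat \<Rightarrow> (nat \<Rightarrow> nat) set" where
  "box_partitions m j = {\<alpha>. is_partition \<alpha> \<and> \<alpha> m = 0 \<and> \<alpha> 0 \<le> j}"

definition wide_partitions :: "nat \<Rightarrow> nat \<Rightarrow> (nat \<Rightarrow> nat) set" where
  "wide_partitions m j = {\<alpha>. is_partition \<alpha> \<and> \<alpha> m = 0 \<and> \<alpha> 0 = j}"

lemma finite_box_partitions [simp]: "finite (box_partitions m j)"
  by (rule finite_subset[OF _ finite_bounded_partitions[of m j]])
    (auto simp: box_partitions_def height_le_iff width_def)

lemma finite_wide_partitions [simp]: "finite (wide_partitions m j)"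
  by (rule finite_subset[OF _ finite_box_partitions[of m j]])
    (auto simp: box_partitions_def wide_partitions_def)

lemma box_partitions_0 [simp]: "box_partitions 0 j = {\<lambda>_. 0}" "box_partitions m 0 = {\<lambda>_. 0}"
  by (auto simp: box_partitions_def dest: partition_eq_zero)

lemma wide_partitions_0 [simp]:
  "wide_partitions m 0 = {\<lambda>_. 0}" "j > 0 \<Longrightarrow> wide_partitions 0 j = {}"
  by (auto simp: wide_partitions_def dest: partition_eq_zero)

lemma wide_partitions_Suc: "wide_partitions (Suc m) j = case_nat j ` box_partitions m j"
proof (intro subset_antisym subsetI)
  fix \<alpha> assume "\<alpha> \<in> wide_partitions (Suc m) j"
  then have "\<alpha> = case_nat j (\<lambda>i. \<alpha> (Suc i))" "(\<lambda>i. \<alpha> (Suc i)) \<in> box_partitions m j"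
    using case_nat_shift[of \<alpha>] is_partition_le[of \<alpha> 0 1]
    by (auto simp: wide_partitions_def box_partitions_def is_partition_shift)
  then show "\<alpha> \<in> case_nat j ` box_partitions m j" by blast
qed (auto simp: wide_partitions_def box_partitions_def)

lemma box_partitions_Suc:
  "box_partitions m (Suc j) = box_partitions m j \<union> wide_partitions m (Suc j)"
  "box_partitions m j \<inter> wide_partitions m (Suc j) = {}"
  by (auto simp: box_partitions_def wide_partitions_def)

text \<open>The Gaussian binomial coefficient \<open>m + j\<close> over \<open>j\<close>.\<close>

definition box_gf :: "nat \<Rightarrow> nat \<Rightarrow> rat fps" where
  "box_gf m j = (\<Sum>\<alpha>\<in>box_partitions m j. fps_X ^ weight \<alpha>)"

lemma box_gf_0 [simp]: "box_gf 0 j = 1" "box_gf m 0 = 1"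
  by (simp_all add: box_gf_def)

lemma sum_wide_partitions:
  "(\<Sum>\<alpha>\<in>wide_partitions (Suc m) j. fps_X ^ weight \<alpha>) = fps_X ^ j * box_gf m j"
  by (simp add: wide_partitions_Suc sum.reindex inj_case_nat box_gf_def sum_distrib_left
      box_partitions_def weight_case_nat power_add)

text \<open>Split by whether the top row attains the maximal length \<open>Suc j\<close>; if so,
  remove it.\<close>

lemma box_gf_Suc: "box_gf (Suc m) (Suc j) = box_gf (Suc m) j + fps_X ^ Suc j * box_gf m (Suc j)"
  unfolding sum_wide_partitions[symmetric]
  by (simp add: box_gf_def box_partitions_Suc sum.union_disjoint)

section \<open>Column statistics\<close>

text \<open>A column of length \<open>c + 1\<close> contributes \<open>c + 1 + y c\<close>.\<close>

definition col_weight :: "(nat \<Rightarrow> nat) \<Rightarrow> (nat \<Rightarrow> nat) \<Rightarrow> nat" where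
  "col_weight lam y = weight lam + (\<Sum>j < lam 0. y (conj_part lam j - 1))"

lemma col_weight_Suc: "col_weight lam (\<lambda>c. Suc (y c)) = lam 0 + col_weight lam y"
  by (simp add: col_weight_def sum_Suc)

text \<open>The new top row lengthens the \<open>lam 0\<close> old columns by one, which shifts the
  index of \<open>y\<close>, and creates \<open>a - lam 0\<close> columns of length 1.\<close>

lemma col_weight_case_nat:
  assumes "is_partition lam" "lam 0 \<le> a"
  shows "col_weight (case_nat a lam) y =
    col_weight lam (\<lambda>c. Suc (y (Suc c))) + (a - lam 0) * Suc (y 0)"
proof -
  have split: "{..<a} = {..<lam 0} \<union> {lam 0..<a}" using assms(2) by auto
  have beyond: "conj_part lam j = 0" if "lam 0 \<le> j" for j
    using conj_part_pos_iff[OF assms(1), of j] that by simp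
  have "(\<Sum>j<a. y (conj_part (case_nat a lam) j - 1)) = (\<Sum>j<a. y (conj_part lam j))"
    using assms(1) by (simp add: conj_part_case_nat)
  also have "\<dots> = (\<Sum>j<lam 0. y (conj_part lam j)) + (\<Sum>j=lam 0..<a. y (conj_part lam j))"
    unfolding split by (rule sum.union_disjoint) auto
  also have "(\<Sum>j=lam 0..<a. y (conj_part lam j)) = (a - lam 0) * y 0"
    using beyond by simp
  also have "(\<Sum>j<lam 0. y (conj_part lam j)) =
      (\<Sum>j<lam 0. y (Suc (conj_part lam j - 1)))"
    using conj_part_pos_iff[OF assms(1)] by simp
  finally show ?thesis
    using assms weight_case_nat[OF assms(1), of a]
    by (simp add: col_weight_Suc) (simp add: col_weight_def)
qed

text \<open>
  The complete homogeneous symmetric polynomial of degree \<open>a\<close> in the \<open>r\<close> variables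
  \<open>q ^ (c + 1 + y c)\<close>, \<open>c < r\<close>: column lengths of a partition form a multiset.
\<close>

definition col_gf :: "nat \<Rightarrow> (nat \<Rightarrow> nat) \<Rightarrow> nat \<Rightarrow> rat fps" where
  "col_gf r y a = (\<Sum>lam\<in>wide_partitions r a. fps_X ^ col_weight lam y)"

lemma col_gf_0 [simp]: "col_gf r y 0 = 1" "a > 0 \<Longrightarrow> col_gf 0 y a = 0"
  by (simp_all add: col_gf_def col_weight_def)

lemma sum_wide_col_weight_shift:
  "(\<Sum>lam\<in>wide_partitions r a. fps_X ^ col_weight lam (\<lambda>c. Suc (y c))) = fps_X ^ a * col_gf r y a"
  by (simp add: col_weight_Suc col_gf_def sum_distrib_left wide_partitions_def power_add)

text \<open>Either no column has length 1, or one such column, of weight \<open>Suc (y 0)\<close>,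
  is removed. In the first case removing the top row shortens all \<open>Suc a\<close> columns,
  whence the power of \<open>fps_X\<close>.\<close>

lemma col_gf_Suc:
  "col_gf (Suc r) y (Suc a) =
    fps_X ^ Suc a * col_gf r (\<lambda>c. y (Suc c)) (Suc a) + fps_X ^ Suc (y 0) * col_gf (Suc r) y a"
proof -
  have "col_gf (Suc r) y (Suc a) =
      (\<Sum>lam\<in>box_partitions r (Suc a). fps_X ^ col_weight (case_nat (Suc a) lam) y)"
    by (simp add: col_gf_def wide_partitions_Suc sum.reindex inj_case_nat)
  also have "\<dots> =
      (\<Sum>lam\<in>box_partitions r a. fps_X ^ col_weight (case_nat (Suc a) lam) y) +
      (\<Sum>lam\<in>wide_partitions r (Suc a). fps_X ^ col_weight (case_nat (Suc a) lam) y)"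
    by (simp add: box_partitions_Suc sum.union_disjoint)
  also have "(\<Sum>lam\<in>wide_partitions r (Suc a). fps_X ^ col_weight (case_nat (Suc a) lam) y) =
      fps_X ^ Suc a * col_gf r (\<lambda>c. y (Suc c)) (Suc a)"
    unfolding sum_wide_col_weight_shift[symmetric]
    by (rule sum.cong) (auto simp: wide_partitions_def col_weight_case_nat)
  also have "(\<Sum>lam\<in>box_partitions r a. fps_X ^ col_weight (case_nat (Suc a) lam) y) =
      (\<Sum>lam\<in>box_partitions r a. fps_X ^ Suc (y 0) * fps_X ^ col_weight (case_nat a lam) y :: rat fps)"
    by (rule sum.cong)
      (auto simp: box_partitions_def col_weight_case_nat Suc_diff_le simp flip: power_add)
  also have "\<dots> = fps_X ^ Suc (y 0) * col_gf (Suc r) y a"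
    by (simp add: col_gf_def wide_partitions_Suc sum.reindex inj_case_nat sum_distrib_left)
  finally show ?thesis by (simp add: add.commute)
qed

section \<open>The signed sum, with the top rows of \<open>lam\<close> and \<open>\<theta>\<close>
  already removed, and its recurrence\<close>

definition signed_gf :: "nat \<Rightarrow> (nat \<Rightarrow> nat) \<Rightarrow> nat \<Rightarrow> rat fps" where
  "signed_gf h y k =
    (\<Sum>a\<le>k. (-1) ^ a * fps_X ^ (a * (a - 1) div 2) * col_gf h y a * box_gf (h + a) (k - a))"

lemma signed_gf_0 [simp]: "signed_gf h y 0 = 1"
  by (simp add: signed_gf_def)

lemma signed_gf_no_rows [simp]: "signed_gf 0 y k = 1"
proof -
  have "signed_gf 0 y k = (\<Sum>a\<le>k. if a = 0 then 1 else 0)"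
    unfolding signed_gf_def by (rule sum.cong) auto
  then show ?thesis by simp
qed

lemma triangle_Suc: "Suc a * (Suc a - 1) div 2 = a * (a - 1) div 2 + a"
  by (cases a) auto

text \<open>\<open>box_gf_Suc\<close> splits off \<open>signed_gf (Suc h) y k\<close>; in the rest,
  \<open>col_gf_Suc\<close> separates the terms with a column of length 1. Shifting \<open>a\<close>
  by one in those flips the sign and gives a multiple of the same signed sum for
  \<open>k\<close>.\<close>

lemma signed_gf_Suc:
  "signed_gf (Suc h) y (Suc k) =
    fps_X ^ Suc k * signed_gf h (\<lambda>c. y (Suc c)) (Suc k) +
    (1 - fps_X ^ (y 0 + Suc k)) * signed_gf (Suc h) y k"
proof -
  define s :: "nat \<Rightarrow> rat fps" where "s a = (-1) ^ a * fps_X ^ (a * (a - 1) div 2)" for a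
  have s_Suc: "s (Suc a) = - (fps_X ^ a * s a)" for a
    unfolding s_def triangle_Suc by (simp add: power_add)
  let ?H = "col_gf (Suc h) y" and ?H' = "col_gf h (\<lambda>c. y (Suc c))"
  let ?G = "\<lambda>a. fps_X ^ (Suc k - a) * box_gf (h + a) (Suc k - a)"
  have pascal: "box_gf (Suc h + a) (Suc k - a) = box_gf (Suc h + a) (k - a) + ?G a"
    if "a \<le> k" for a
    using that box_gf_Suc[of "h + a" "k - a"] by (simp add: Suc_diff_le)
  have "signed_gf (Suc h) y (Suc k) =
      (\<Sum>a\<le>k. s a * ?H a * box_gf (Suc h + a) (Suc k - a)) + s (Suc k) * ?H (Suc k)"
    by (simp add: signed_gf_def s_def)
  also have "(\<Sum>a\<le>k. s a * ?H a * box_gf (Suc h + a) (Suc k - a)) =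
      (\<Sum>a\<le>k. s a * ?H a * box_gf (Suc h + a) (k - a) + s a * ?H a * ?G a)"
    by (intro sum.cong refl) (simp only: pascal atMost_iff distrib_left)
  also have "\<dots> = signed_gf (Suc h) y k + (\<Sum>a\<le>k. s a * ?H a * ?G a)"
    by (simp add: sum.distrib signed_gf_def s_def)
  \<comment> \<open>The term \<open>a = Suc k\<close> joins the sum because
    \<open>?G (Suc k) = 1\<close>, the box having width 0.\<close>
  finally have 1: "signed_gf (Suc h) y (Suc k) =
      signed_gf (Suc h) y k + (\<Sum>a\<le>Suc k. s a * ?H a * ?G a)"
    by simp
  have "(\<Sum>a\<le>Suc k. s a * ?H a * ?G a) = ?G 0 * s 0 + (\<Sum>a\<le>k. s (Suc a) * ?H (Suc a) * ?G (Suc a))"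
    by (subst sum.atMost_Suc_shift) simp
  also have "(\<Sum>a\<le>k. s (Suc a) * ?H (Suc a) * ?G (Suc a)) =
      (\<Sum>a\<le>k. s (Suc a) * (fps_X ^ Suc a * ?H' (Suc a)) * ?G (Suc a) +
        s (Suc a) * (fps_X ^ Suc (y 0) * ?H a) * ?G (Suc a))"
    by (intro sum.cong refl) (simp only: col_gf_Suc distrib_left distrib_right)
  also have "\<dots> = (\<Sum>a\<le>k. s (Suc a) * (fps_X ^ Suc a * ?H' (Suc a)) * ?G (Suc a)) +
      (\<Sum>a\<le>k. s (Suc a) * (fps_X ^ Suc (y 0) * ?H a) * ?G (Suc a))"
    by (rule sum.distrib)
  also have "(\<Sum>a\<le>k. s (Suc a) * (fps_X ^ Suc (y 0) * ?H a) * ?G (Suc a)) =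
      - (fps_X ^ (y 0 + Suc k)) * signed_gf (Suc h) y k"
    unfolding signed_gf_def sum_distrib_left
  proof (rule sum.cong)
    fix a assume "a \<in> {..k}"
    \<comment> \<open>The exponents \<open>a\<close> from \<open>s_Suc\<close>,
      \<open>Suc (y 0)\<close> from the removed column and \<open>k - a\<close> from
      \<open>?G\<close> have a sum free of \<open>a\<close>.\<close>
    then have "fps_X ^ (y 0 + Suc k) = (fps_X ^ a * fps_X ^ Suc (y 0) * fps_X ^ (k - a) :: rat fps)"
      by (simp flip: power_add add: ac_simps)
    then show "s (Suc a) * (fps_X ^ Suc (y 0) * ?H a) * ?G (Suc a) =
        - (fps_X ^ (y 0 + Suc k)) * ((-1) ^ a * fps_X ^ (a * (a - 1) div 2) * ?H a *
          box_gf (Suc h + a) (k - a))"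
      unfolding s_Suc by (simp only: s_def diff_Suc_Suc) (simp add: algebra_simps)
  qed simp
  \<comment> \<open>Since \<open>?H' 0 = 1\<close>, the isolated summand is the missing term
    \<open>a = 0\<close>; \<open>z\<close> stands for the part already evaluated.\<close>
  also have "?G 0 * s 0 + ((\<Sum>a\<le>k. s (Suc a) * (fps_X ^ Suc a * ?H' (Suc a)) * ?G (Suc a)) + z) =
      (\<Sum>a\<le>Suc k. s a * (fps_X ^ a * ?H' a) * ?G a) + z" for z
    by (subst sum.atMost_Suc_shift) simp
  also have "(\<Sum>a\<le>Suc k. s a * (fps_X ^ a * ?H' a) * ?G a) =
      fps_X ^ Suc k * signed_gf h (\<lambda>c. y (Suc c)) (Suc k)"
    unfolding signed_gf_def sum_distrib_left
  proof (rule sum.cong)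
    fix a assume "a \<in> {..Suc k}"
    then have "fps_X ^ Suc k = (fps_X ^ a * fps_X ^ (Suc k - a) :: rat fps)"
      by (simp flip: power_add)
    then show "s a * (fps_X ^ a * ?H' a) * ?G a = fps_X ^ Suc k *
        ((-1) ^ a * fps_X ^ (a * (a - 1) div 2) * ?H' a * box_gf (h + a) (Suc k - a))"
      by (simp only: s_def ac_simps)
  qed simp
  finally show ?thesis unfolding 1 by (simp add: algebra_simps)
qed

section \<open>Embeddings of Ferrers boards\<close>

text \<open>
  \<open>S\<close> is the set of kept columns and \<open>g\<close> enumerates the kept rows. The board of \<open>\<mu>\<close> is padded
  to \<open>w\<close> columns and that of \<open>\<alpha>\<close> to \<open>n\<close> columns, and both to infinitely many rows, so that the
  recursion can strip one row or one column at a time.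
\<close>

definition embeds :: "(nat \<Rightarrow> nat) \<Rightarrow> nat \<Rightarrow> (nat \<Rightarrow> nat) \<Rightarrow> nat \<Rightarrow> bool" where
  "embeds \<mu> w \<alpha> n \<longleftrightarrow> (\<exists>S g. S \<subseteq> {..<n} \<and> card S = w \<and> strict_mono g \<and>
     (\<forall>i. card (S \<inter> {..<\<alpha> (g i)}) = \<mu> i))"

lemma embedsI:
  assumes "S \<subseteq> {..<n}" "card S = w" "strict_mono g" "\<And>i. card (S \<inter> {..<\<alpha> (g i)}) = \<mu> i"
  shows "embeds \<mu> w \<alpha> n"
  using assms unfolding embeds_def by blast

lemma embedsE:
  assumes "embeds \<mu> w \<alpha> n"
  obtains S g where "S \<subseteq> {..<n}" "finite S" "card S = w" "strict_mono g"
    "\<And>i. card (S \<inter> {..<\<alpha> (g i)}) = \<mu> i"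
  using assms unfolding embeds_def by (metis finite_lessThan finite_subset)

text \<open>As \<open>\<mu> 0 = w\<close>, row \<open>g 0\<close> meets all kept columns, so these
  lie within its length, which is at most \<open>n\<close>.\<close>

lemma embeds_full_drop_column:
  assumes "is_partition \<alpha>" "\<alpha> 0 \<le> n" "\<mu> 0 = w"
  shows "embeds \<mu> w \<alpha> (Suc n) \<longleftrightarrow> embeds \<mu> w \<alpha> n"
proof
  assume "embeds \<mu> w \<alpha> (Suc n)"
  then obtain S g where S: "finite S" "card S = w" "strict_mono g"
    "\<And>i. card (S \<inter> {..<\<alpha> (g i)}) = \<mu> i" by (elim embedsE) (rule that)
  have "S \<inter> {..<\<alpha> (g 0)} = S"
    using S(1,2) S(4)[of 0] assms(3) by (intro card_subset_eq) auto
  moreover have "\<alpha> (g 0) \<le> n" using is_partition_le[OF assms(1), of 0 "g 0"] assms(2) by simp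
  ultimately have "S \<subseteq> {..<n}" by (metis Int_lower2 lessThan_subset_iff order_trans)
  with S show "embeds \<mu> w \<alpha> n" by (intro embedsI)
next
  assume "embeds \<mu> w \<alpha> n"
  then show "embeds \<mu> w \<alpha> (Suc n)" by (elim embedsE) (rule embedsI, auto)
qed

lemma embeds_slack_drop_column:
  assumes "is_partition \<alpha>" "\<alpha> 0 \<le> n" "is_partition \<mu>" "\<mu> 0 \<le> w"
  shows "embeds \<mu> (Suc w) \<alpha> (Suc n) \<longleftrightarrow> embeds \<mu> w \<alpha> n"
proof
  assume "embeds \<mu> (Suc w) \<alpha> (Suc n)"
  then obtain S g where S: "S \<subseteq> {..<Suc n}" "finite S" "card S = Suc w" "strict_mono g"
    "\<And>i. card (S \<inter> {..<\<alpha> (g i)}) = \<mu> i" by (elim embedsE) (rule that)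
  define m where "m = Max S"
  have "S \<noteq> {}" using S(3) by auto
  then have m: "m \<in> S" "\<And>s. s \<in> S \<Longrightarrow> s \<le> m" using S(2) by (auto simp: m_def)
  have "\<alpha> (g i) \<le> m" for i
  proof (rule ccontr)
    assume "\<not> \<alpha> (g i) \<le> m"
    then have "S \<inter> {..<\<alpha> (g i)} = S" using m(2) by fastforce
    then have "\<mu> i = Suc w" using S(3) S(5)[of i] by simp
    then show False using is_partition_le[OF assms(3), of 0 i] assms(4) by simp
  qed
  then have "m \<notin> {..<\<alpha> (g i)}" for i by (simp add: not_less)
  then have "(S - {m}) \<inter> {..<\<alpha> (g i)} = S \<inter> {..<\<alpha> (g i)}" for i by blast
  moreover have "S - {m} \<subseteq> {..<n}" using S(1) m by fastforce
  ultimately show "embeds \<mu> w \<alpha> n" using S m by (intro embedsI[of "S - {m}" _ _ g]) auto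
next
  assume "embeds \<mu> w \<alpha> n"
  then obtain S g where S: "S \<subseteq> {..<n}" "finite S" "card S = w" "strict_mono g"
    "\<And>i. card (S \<inter> {..<\<alpha> (g i)}) = \<mu> i" by (elim embedsE) (rule that)
  have "\<alpha> (g i) \<le> n" for i using is_partition_le[OF assms(1), of 0 "g i"] assms(2) by simp
  then have "n \<notin> {..<\<alpha> (g i)}" for i by (simp add: not_less)
  then have "insert n S \<inter> {..<\<alpha> (g i)} = S \<inter> {..<\<alpha> (g i)}" for i by blast
  moreover have "n \<notin> S" using S(1) by auto
  ultimately show "embeds \<mu> (Suc w) \<alpha> (Suc n)"
    using S by (intro embedsI[of "insert n S" _ _ g]) auto
qed

text \<open>A row of length \<open>n\<close> meets all \<open>w\<close> kept columns, more than
  \<open>\<mu> 0\<close>, so it is not the first kept row; as \<open>g\<close> increases, it is not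
  kept at all.\<close>

lemma embeds_slack_drop_row:
  assumes "\<mu> 0 < w"
  shows "embeds \<mu> w (case_nat n \<alpha>) n \<longleftrightarrow> embeds \<mu> w \<alpha> n"
proof
  assume "embeds \<mu> w (case_nat n \<alpha>) n"
  then obtain S g where S: "S \<subseteq> {..<n}" "card S = w" "strict_mono g"
    "\<And>i. card (S \<inter> {..<case_nat n \<alpha> (g i)}) = \<mu> i" by (elim embedsE) (rule that)
  have "g 0 \<noteq> 0"
  proof
    assume "g 0 = 0"
    then have "\<mu> 0 = w" using S(1,2) S(4)[of 0] by (simp add: Int_absorb2)
    then show False using assms by simp
  qed
  then have pos: "g i > 0" for i
    using strict_mono_less_eq[OF S(3), of 0 i] by simp
  have "strict_mono (\<lambda>i. g i - 1)"
    using S(3) pos unfolding strict_mono_def by (metis diff_less_mono Suc_leI One_nat_def)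
  moreover have "\<alpha> (g i - 1) = case_nat n \<alpha> (g i)" for i
    using pos[of i] by (simp split: nat.split)
  ultimately show "embeds \<mu> w \<alpha> n" using S by (intro embedsI[of S _ _ "\<lambda>i. g i - 1"]) auto
next
  assume "embeds \<mu> w \<alpha> n"
  then obtain S g where S: "S \<subseteq> {..<n}" "card S = w" "strict_mono g"
    "\<And>i. card (S \<inter> {..<\<alpha> (g i)}) = \<mu> i" by (elim embedsE) (rule that)
  then show "embeds \<mu> w (case_nat n \<alpha>) n"
    by (intro embedsI[of S _ _ "\<lambda>i. Suc (g i)"]) (auto simp: strict_mono_def)
qed

text \<open>The top row meets all \<open>w\<close> kept columns, so it can serve as first kept row
  whatever \<open>g 0\<close> was; the later kept rows lie below it.\<close>

lemma embeds_full_drop_row: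
  assumes "\<mu> 0 = w"
  shows "embeds \<mu> w (case_nat n \<alpha>) n \<longleftrightarrow> embeds (\<lambda>i. \<mu> (Suc i)) w \<alpha> n"
proof
  assume "embeds \<mu> w (case_nat n \<alpha>) n"
  then obtain S g where S: "S \<subseteq> {..<n}" "card S = w" "strict_mono g"
    "\<And>i. card (S \<inter> {..<case_nat n \<alpha> (g i)}) = \<mu> i" by (elim embedsE) (rule that)
  have pos: "g (Suc i) > 0" for i
    using strict_monoD[OF S(3), of 0 "Suc i"] by simp
  have "strict_mono (\<lambda>i. g (Suc i) - 1)"
    using S(3) pos unfolding strict_mono_def
    by (metis diff_less_mono Suc_leI One_nat_def Suc_less_eq)
  moreover have "\<alpha> (g (Suc i) - 1) = case_nat n \<alpha> (g (Suc i))" for i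
    using pos[of i] by (simp split: nat.split)
  ultimately show "embeds (\<lambda>i. \<mu> (Suc i)) w \<alpha> n"
    using S by (intro embedsI[of S _ _ "\<lambda>i. g (Suc i) - 1"]) auto
next
  assume "embeds (\<lambda>i. \<mu> (Suc i)) w \<alpha> n"
  then obtain S g where S: "S \<subseteq> {..<n}" "card S = w" "strict_mono g"
    "\<And>i. card (S \<inter> {..<\<alpha> (g i)}) = \<mu> (Suc i)" by (elim embedsE) (rule that)
  then show "embeds \<mu> w (case_nat n \<alpha>) n"
    using assms
    by (intro embedsI[of S _ _ "case_nat 0 (\<lambda>i. Suc (g i))"])
      (auto simp: strict_mono_def Int_absorb2 split: nat.split)
qed

lemma embeds_wide: "embeds \<mu> w \<alpha> n \<Longrightarrow> w \<le> n"
  by (metis card_lessThan card_mono embedsE finite_lessThan)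

section \<open>Deletion of rows and columns in terms of embeddings\<close>

lemma delete_lines_clip:
  assumes "is_partition \<alpha>"
  shows "delete_lines (R \<inter> {..<height \<alpha>}) (C \<inter> {..<width \<alpha>}) (board \<alpha>) =
    delete_lines R C (board \<alpha>)"
proof -
  have *: "i < height \<alpha>" "j < width \<alpha>" if "(i, j) \<in> board \<alpha>" for i j
    using that part_zero_beyond_height[OF assms, of i] is_partition_le[OF assms, of 0 i]
    by (auto simp: board_def width_def not_less[symmetric])
  show ?thesis
    unfolding delete_lines_def
  proof (rule image_cong)
    show "{(i, j). (i, j) \<in> board \<alpha> \<and> i \<notin> R \<inter> {..<height \<alpha>} \<and> j \<notin> C \<inter> {..<width \<alpha>}} =
        {(i, j). (i, j) \<in> board \<alpha> \<and> i \<notin> R \<and> j \<notin> C}"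
      using * by auto
  next
    fix p assume "p \<in> {(i, j). (i, j) \<in> board \<alpha> \<and> i \<notin> R \<and> j \<notin> C}"
    then obtain i j where p: "p = (i, j)" "i < height \<alpha>" "j < width \<alpha>" using * by auto
    have "{i'. i' < i \<and> i' \<notin> R \<inter> {..<height \<alpha>}} = {i'. i' < i \<and> i' \<notin> R}"
      "{j'. j' < j \<and> j' \<notin> C \<inter> {..<width \<alpha>}} = {j'. j' < j \<and> j' \<notin> C}"
      using p by auto
    then show "(case p of (i, j) \<Rightarrow> (card {i'. i' < i \<and> i' \<notin> R \<inter> {..<height \<alpha>}},
          card {j'. j' < j \<and> j' \<notin> C \<inter> {..<width \<alpha>}})) =
        (case p of (i, j) \<Rightarrow> (card {i'. i' < i \<and> i' \<notin> R}, card {j'. j' < j \<and> j' \<notin> C}))"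
      by (simp add: p)
  qed
qed

lemma image_rank: "(\<lambda>j. card (S \<inter> {..<j})) ` (S \<inter> {..<m}) = {..<card (S \<inter> {..<m :: nat})}"
proof (induction m)
  case (Suc m)
  show ?case
  proof (cases "m \<in> S")
    case True
    then have "S \<inter> {..<Suc m} = insert m (S \<inter> {..<m})" by auto
    then show ?thesis using Suc by (simp add: lessThan_Suc)
  next
    case False
    then have "S \<inter> {..<Suc m} = S \<inter> {..<m}" by (auto simp: less_Suc_eq)
    then show ?thesis using Suc by simp
  qed
qed simp

text \<open>Row \<open>g i\<close> has exactly \<open>i\<close> kept rows above it, and by
  \<open>image_rank\<close> its surviving cells are renumbered to an initial segment.\<close>

lemma delete_lines_board:
  assumes g: "strict_mono g"
  shows "delete_lines (- range g) (- S) (board \<alpha>) = board (\<lambda>i. card (S \<inter> {..<\<alpha> (g i)}))"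
proof -
  have rows: "{i'. i' < g i \<and> i' \<in> range g} = g ` {..<i}" for i
    using strict_mono_less[OF g] by auto
  have "card {i'. i' < g i \<and> i' \<in> range g} = i" for i
    unfolding rows by (simp add: card_image strict_mono_imp_inj_on[OF g] inj_on_subset)
  moreover have "{j'. j' < j \<and> j' \<in> S} = S \<inter> {..<j}" for j by auto
  ultimately have "delete_lines (- range g) (- S) (board \<alpha>) =
      {(i, v). v \<in> (\<lambda>j. card (S \<inter> {..<j})) ` (S \<inter> {..<\<alpha> (g i)})}"
    by (force simp: delete_lines_def board_def image_iff)
  then show ?thesis by (simp add: image_rank board_def)
qed

lemma board_inject: "board \<mu> = board \<nu> \<longleftrightarrow> \<mu> = \<nu>"
proof
  assume "board \<mu> = board \<nu>"
  then have "{j. (i, j) \<in> board \<mu>} = {j. (i, j) \<in> board \<nu>}" for i by simp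
  then have "{..<\<mu> i} = {..<\<nu> i}" for i by (simp add: board_def lessThan_def)
  then show "\<mu> = \<nu>" by auto
qed simp

lemma contains_iff_embeds:
  assumes "is_partition \<alpha>"
  shows "contains \<alpha> \<mu> \<longleftrightarrow> embeds \<mu> (\<mu> 0) \<alpha> (\<alpha> 0)"
proof
  assume "contains \<alpha> \<mu>"
  then obtain R C where R: "R \<subseteq> {..<height \<alpha>}"
    and eq: "delete_lines R C (board \<alpha>) = board \<mu>"
    unfolding contains_def by auto
  \<comment> \<open>Only finitely many rows are deleted, so the kept ones, including empty rows
    below the board, can be enumerated by \<open>g\<close>.\<close>
  have "infinite (- R)"
    using R finite_subset by (metis finite_Diff2 Compl_eq_Diff_UNIV finite_lessThan infinite_UNIV_nat)
  then have g: "strict_mono (enumerate (- R))" "range (enumerate (- R)) = - R"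
    by (auto simp: strict_mono_enumerate range_enumerate)
  define g where "g = enumerate (- R)"
  have \<mu>: "card (- C \<inter> {..<\<alpha> (g i)}) = \<mu> i" for i
    using delete_lines_board[OF g(1), of "- C" \<alpha>] eq
    by (auto simp: g(2) board_inject g_def)
  have "\<alpha> (g i) \<le> \<alpha> (g 0)" for i
    using is_partition_le[OF assms] strict_mono_less_eq[OF g(1)] by (simp add: g_def)
  \<comment> \<open>Columns beyond row \<open>g 0\<close> meet no kept row; cutting them off leaves
    exactly \<open>\<mu> 0\<close> columns.\<close>
  then have "- C \<inter> {..<\<alpha> (g 0)} \<inter> {..<\<alpha> (g i)} = - C \<inter> {..<\<alpha> (g i)}" for i
    by (auto dest: less_le_trans)
  moreover have "\<alpha> (g 0) \<le> \<alpha> 0" using is_partition_le[OF assms] by simp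
  ultimately show "embeds \<mu> (\<mu> 0) \<alpha> (\<alpha> 0)"
    using \<mu> g(1) by (intro embedsI[of "- C \<inter> {..<\<alpha> (g 0)}" _ _ g]) (auto simp: g_def)
next
  assume "embeds \<mu> (\<mu> 0) \<alpha> (\<alpha> 0)"
  then obtain S g where g: "strict_mono g" and "\<And>i. card (S \<inter> {..<\<alpha> (g i)}) = \<mu> i"
    by (elim embedsE) (rule that)
  \<comment> \<open>Clipping is needed because \<open>contains\<close> only deletes rows and columns
    of the board itself.\<close>
  then have "delete_lines (- range g \<inter> {..<height \<alpha>}) (- S \<inter> {..<width \<alpha>}) (board \<alpha>) = board \<mu>"
    unfolding delete_lines_clip[OF assms] delete_lines_board[OF g] by simp
  then show "contains \<alpha> \<mu>" unfolding contains_def by (metis Int_lower2)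
qed

section \<open>The generating function of partitions containing a given one\<close>

text \<open>Given by coefficients because \<open>A\<close> may be infinite; for partitions, a bound
  on the width makes each counted set finite.\<close>

definition part_gf :: "(nat \<Rightarrow> nat) set \<Rightarrow> rat fps" where
  "part_gf A = Abs_fps (\<lambda>n. of_nat (card {\<alpha> \<in> A. weight \<alpha> = n}))"

text \<open>The \<open>part_gf\<close> of this set is the series \<open>T \<mu> w n\<close> of the
  introduction.\<close>

definition embedding_partitions :: "(nat \<Rightarrow> nat) \<Rightarrow> nat \<Rightarrow> nat \<Rightarrow> (nat \<Rightarrow> nat) set" where
  "embedding_partitions \<mu> w n = {\<alpha>. is_partition \<alpha> \<and> \<alpha> 0 \<le> n \<and> embeds \<mu> w \<alpha> n}"

lemma part_gf_case_nat:
  assumes "A \<subseteq> {\<alpha>. is_partition \<alpha>}"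
  shows "part_gf (case_nat n ` A) = fps_X ^ n * part_gf A"
proof (rule fps_ext)
  fix m
  have "{\<alpha> \<in> case_nat n ` A. weight \<alpha> = m} = case_nat n ` {\<alpha> \<in> A. n + weight \<alpha> = m}"
    using assms by (auto simp: weight_case_nat subset_iff)
  then have "card {\<alpha> \<in> case_nat n ` A. weight \<alpha> = m} = card {\<alpha> \<in> A. n + weight \<alpha> = m}"
    by (simp add: card_image inj_case_nat)
  also have "{\<alpha> \<in> A. n + weight \<alpha> = m} = (if m < n then {} else {\<alpha> \<in> A. weight \<alpha> = m - n})"
    by auto
  finally show "fps_nth (part_gf (case_nat n ` A)) m = fps_nth (fps_X ^ n * part_gf A) m"
    by (simp add: part_gf_def fps_X_power_mult_nth)
qed

lemma part_gf_Un:
  assumes "A \<union> B \<subseteq> {\<alpha>. is_partition \<alpha> \<and> \<alpha> 0 \<le> n}" "A \<inter> B = {}"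
  shows "part_gf (A \<union> B) = part_gf A + part_gf B"
proof (rule fps_ext)
  fix m
  have fin: "finite {\<alpha> \<in> A \<union> B. weight \<alpha> = m}"
    by (rule finite_subset[OF _ finite_bounded_partitions[of m n]])
      (use assms(1) in \<open>auto simp: width_def subset_iff intro: height_le_weight\<close>)
  have "{\<alpha> \<in> A \<union> B. weight \<alpha> = m} = {\<alpha> \<in> A. weight \<alpha> = m} \<union> {\<alpha> \<in> B. weight \<alpha> = m}"
    by auto
  then have "card {\<alpha> \<in> A \<union> B. weight \<alpha> = m} =
      card {\<alpha> \<in> A. weight \<alpha> = m} + card {\<alpha> \<in> B. weight \<alpha> = m}"
    using fin assms(2) by (metis (no_types, lifting) card_Un_disjoint disjoint_iff finite_Un mem_Collect_eq)
  then show "fps_nth (part_gf (A \<union> B)) m = fps_nth (part_gf A + part_gf B) m"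
    by (simp add: part_gf_def)
qed

text \<open>Either the first row of \<open>\<alpha>\<close> has full length \<open>Suc n\<close> and
  is removed, or the last column is empty and is removed.\<close>

lemma part_gf_embedding_split:
  assumes row: "\<And>\<alpha>. embeds \<mu> w (case_nat (Suc n) \<alpha>) (Suc n) \<longleftrightarrow> embeds \<mu>' w \<alpha> (Suc n)"
    and col: "\<And>\<alpha>. is_partition \<alpha> \<Longrightarrow> \<alpha> 0 \<le> n \<Longrightarrow> embeds \<mu> w \<alpha> (Suc n) \<longleftrightarrow> embeds \<mu> w' \<alpha> n"
  shows "part_gf (embedding_partitions \<mu> w (Suc n)) =
    fps_X ^ Suc n * part_gf (embedding_partitions \<mu>' w (Suc n)) +
    part_gf (embedding_partitions \<mu> w' n)"
proof -
  let ?A = "case_nat (Suc n) ` embedding_partitions \<mu>' w (Suc n)"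
  let ?B = "embedding_partitions \<mu> w' n"
  have "\<alpha> \<in> ?A" if \<alpha>: "is_partition \<alpha>" "\<alpha> 0 = Suc n" "embeds \<mu> w \<alpha> (Suc n)" for \<alpha>
  proof -
    have "\<alpha> = case_nat (Suc n) (\<lambda>i. \<alpha> (Suc i))"
      using case_nat_shift[of \<alpha>] \<alpha>(2) by simp
    moreover have "(\<lambda>i. \<alpha> (Suc i)) \<in> embedding_partitions \<mu>' w (Suc n)"
      using \<alpha> row[of "\<lambda>i. \<alpha> (Suc i)"] calculation is_partition_shift[OF \<alpha>(1)]
        is_partition_le[OF \<alpha>(1), of 0 1] by (simp add: embedding_partitions_def)
    ultimately show ?thesis by blast
  qed
  then have "embedding_partitions \<mu> w (Suc n) = ?A \<union> ?B"
    using row col by (auto simp: embedding_partitions_def le_Suc_eq)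
  moreover have "part_gf (?A \<union> ?B) = part_gf ?A + part_gf ?B"
    by (rule part_gf_Un[of _ _ "Suc n"]) (auto simp: embedding_partitions_def)
  moreover have "part_gf ?A = fps_X ^ Suc n * part_gf (embedding_partitions \<mu>' w (Suc n))"
    by (rule part_gf_case_nat) (auto simp: embedding_partitions_def)
  ultimately show ?thesis by simp
qed

lemma part_gf_embedding_full:
  assumes "\<mu> 0 = w"
  shows "part_gf (embedding_partitions \<mu> w (Suc n)) =
    fps_X ^ Suc n * part_gf (embedding_partitions (\<lambda>i. \<mu> (Suc i)) w (Suc n)) +
    part_gf (embedding_partitions \<mu> w n)"
  using assms
  by (intro part_gf_embedding_split embeds_full_drop_row embeds_full_drop_column)

text \<open>Removing a full row leaves \<open>\<mu>\<close> unchanged, so the same series stands on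
  both sides and can be solved for.\<close>

lemma part_gf_embedding_slack:
  assumes "is_partition \<mu>" "\<mu> 0 \<le> w"
  shows "(1 - fps_X ^ Suc n) * part_gf (embedding_partitions \<mu> (Suc w) (Suc n)) =
    part_gf (embedding_partitions \<mu> w n)"
proof -
  have "part_gf (embedding_partitions \<mu> (Suc w) (Suc n)) =
      fps_X ^ Suc n * part_gf (embedding_partitions \<mu> (Suc w) (Suc n)) +
      part_gf (embedding_partitions \<mu> w n)"
    using assms
    by (intro part_gf_embedding_split embeds_slack_drop_row embeds_slack_drop_column) auto
  then show ?thesis by (simp add: algebra_simps)
qed

text \<open>Outer induction on the number \<open>w + k\<close> of columns, inner induction on
  \<open>h\<close>: removing a column lowers the former, removing the first row of
  \<open>\<mu>\<close> lowers the latter.\<close>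

lemma part_gf_embedding_partitions:
  assumes "is_partition \<mu>" "\<mu> h = 0" "\<mu> 0 \<le> w"
  shows "(\<Prod>i = 1..w + k. 1 - fps_X ^ i) * part_gf (embedding_partitions \<mu> w (w + k)) =
    fps_X ^ weight \<mu> * signed_gf h \<mu> k"
  using assms
proof (induction "w + k" arbitrary: w k h \<mu>)
  case 0
  then have [simp]: "\<mu> = (\<lambda>_. 0)" "w = 0" "k = 0" using partition_eq_zero by auto
  have "embeds \<mu> 0 (\<lambda>_. 0) 0" by (rule embedsI[of "{}" _ _ id]) (auto simp: strict_mono_def)
  then have "embedding_partitions \<mu> 0 0 = {\<lambda>_. 0}"
    by (auto simp: embedding_partitions_def dest: partition_eq_zero)
  moreover have "part_gf {\<lambda>_. 0} = 1"
  proof (rule fps_ext)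
    fix m
    have "{\<alpha> \<in> {\<lambda>_. 0}. weight \<alpha> = m} = (if m = 0 then {\<lambda>_. 0} else {})" by auto
    then show "fps_nth (part_gf {\<lambda>_. 0}) m = fps_nth 1 m" by (simp add: part_gf_def)
  qed
  ultimately show ?case by simp
next
  case (Suc n)
  note wk = Suc.hyps(2)[symmetric]
  let ?P = "\<lambda>n. \<Prod>i = 1..n. 1 - fps_X ^ i :: rat fps"
  let ?T = "\<lambda>\<mu> w n. part_gf (embedding_partitions \<mu> w n)"
  have P_Suc: "?P (Suc n) = ?P n * (1 - fps_X ^ Suc n)" by simp
  from Suc.prems show ?case
  proof (induction h arbitrary: \<mu>)
    case 0
    then have [simp]: "\<mu> = (\<lambda>_. 0)" using partition_eq_zero by auto
    show ?case
    proof (cases w)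
      case 0
      \<comment> \<open>Here \<open>\<mu>\<close> is both full and equal to its own tail, so the
        full recurrence can be solved like the slack one.\<close>
      have "(1 - fps_X ^ Suc n) * ?T \<mu> w (Suc n) = ?T \<mu> w n"
        using part_gf_embedding_full[of \<mu> w n] 0 by (simp add: algebra_simps)
      then have "?P (Suc n) * ?T \<mu> w (Suc n) = ?P n * ?T \<mu> w n"
        by (simp only: P_Suc mult.assoc)
      moreover have "?P n * ?T \<mu> w n = fps_X ^ weight \<mu> * signed_gf 0 \<mu> k"
        using Suc.hyps(1)[of w n \<mu> 0] 0 by simp
      ultimately show ?thesis by (simp only: wk)
    next
      case (Suc w')
      then have "(1 - fps_X ^ Suc n) * ?T \<mu> w (Suc n) = ?T \<mu> w' n"
        using part_gf_embedding_slack[of \<mu> w' n] by simp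
      then have "?P (Suc n) * ?T \<mu> w (Suc n) = ?P n * ?T \<mu> w' n"
        by (simp only: P_Suc mult.assoc)
      moreover have "?P n * ?T \<mu> w' n = fps_X ^ weight \<mu> * signed_gf 0 \<mu> k"
        using Suc.hyps(1)[of w' k \<mu> 0] wk Suc by simp
      ultimately show ?thesis by (simp only: wk)
    qed
  next
    case (Suc h)
    show ?case
    proof (cases "\<mu> 0 = w")
      case True
      have \<nu>: "(\<Prod>i = 1..w + k. 1 - fps_X ^ i) * ?T (\<lambda>i. \<mu> (Suc i)) w (w + k) =
          fps_X ^ weight (\<lambda>i. \<mu> (Suc i)) * signed_gf h (\<lambda>i. \<mu> (Suc i)) k"
        using Suc.prems is_partition_le[of \<mu> 0 1] by (intro Suc.IH) (auto intro: is_partition_shift)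
      have \<mu>: "weight \<mu> = w + weight (\<lambda>i. \<mu> (Suc i))"
        using weight_shift[OF Suc.prems(1)] True by simp
      have "?P (Suc n) * ?T \<mu> w (Suc n) =
          fps_X ^ Suc n * (?P (Suc n) * ?T (\<lambda>i. \<mu> (Suc i)) w (Suc n)) + ?P (Suc n) * ?T \<mu> w n"
        unfolding part_gf_embedding_full[of \<mu> w, OF True] by (simp only: distrib_left ac_simps)
      also have "?P (Suc n) * ?T (\<lambda>i. \<mu> (Suc i)) w (Suc n) =
          fps_X ^ weight (\<lambda>i. \<mu> (Suc i)) * signed_gf h (\<lambda>i. \<mu> (Suc i)) k"
        using \<nu> by (simp only: wk)
      also have "fps_X ^ Suc n * (fps_X ^ weight (\<lambda>i. \<mu> (Suc i)) * signed_gf h (\<lambda>i. \<mu> (Suc i)) k) =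
          fps_X ^ weight \<mu> * (fps_X ^ k * signed_gf h (\<lambda>i. \<mu> (Suc i)) k)"
        unfolding wk[symmetric] \<mu> by (simp only: power_add ac_simps)
      also have "?P (Suc n) * ?T \<mu> w n = (1 - fps_X ^ Suc n) * (?P n * ?T \<mu> w n)"
        by (simp only: P_Suc ac_simps)
      finally have eq: "?P (Suc n) * ?T \<mu> w (Suc n) =
          fps_X ^ weight \<mu> * (fps_X ^ k * signed_gf h (\<lambda>i. \<mu> (Suc i)) k) +
          (1 - fps_X ^ Suc n) * (?P n * ?T \<mu> w n)" .
      show ?thesis
      proof (cases k)
        case 0
        \<comment> \<open>Now \<open>w = Suc n\<close>, and that many columns cannot be chosen among
          \<open>n\<close>.\<close>
        then have "embedding_partitions \<mu> w n = {}"
          using wk by (auto simp: embedding_partitions_def dest: embeds_wide)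
        moreover have "part_gf {} = 0" by (rule fps_ext) (simp add: part_gf_def)
        ultimately show ?thesis using eq unfolding wk by (simp add: 0)
      next
        case (Suc k')
        then have n: "n = w + k'" using wk by simp
        have "?P n * ?T \<mu> w n = fps_X ^ weight \<mu> * signed_gf (Suc h) \<mu> k'"
          using Suc.hyps(1)[of w k' \<mu> "Suc h"] Suc.prems n by simp
        \<comment> \<open>By \<open>\<mu> 0 + Suc k' = Suc n\<close> the factor in
          \<open>signed_gf_Suc\<close> is the one in \<open>eq\<close>.\<close>
        then show ?thesis
          using eq unfolding wk by (simp only: Suc signed_gf_Suc True n distrib_left add_Suc_right ac_simps)
      qed
    next
      case False
      then obtain w' where w': "w = Suc w'" "\<mu> 0 \<le> w'"
        using Suc.prems(3) by (cases w) auto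
      then have "(1 - fps_X ^ Suc n) * ?T \<mu> w (Suc n) = ?T \<mu> w' n"
        using part_gf_embedding_slack[of \<mu> w' n] Suc.prems by simp
      then have "?P (Suc n) * ?T \<mu> w (Suc n) = ?P n * ?T \<mu> w' n"
        by (simp only: P_Suc mult.assoc)
      moreover have "?P n * ?T \<mu> w' n = fps_X ^ weight \<mu> * signed_gf (Suc h) \<mu> k"
        using Suc.hyps(1)[of w' k \<mu> "Suc h"] wk w' Suc.prems by simp
      ultimately show ?thesis by (simp only: wk)
    qed
  qed
qed

text \<open>Exact width means a full top row; \<open>embeds_full_drop_row\<close> removes it
  together with the first row of \<open>\<mu>\<close>, and only a bound on the width
  remains.\<close>

lemma gen_fun_eq_part_gf:
  assumes "is_partition \<mu>" "width \<mu> + k > 0"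
  shows "gen_fun \<mu> k = fps_X ^ (width \<mu> + k) *
    part_gf (embedding_partitions (\<lambda>i. \<mu> (Suc i)) (width \<mu>) (width \<mu> + k))"
proof -
  let ?n = "width \<mu> + k"
  let ?A = "embedding_partitions (\<lambda>i. \<mu> (Suc i)) (width \<mu>) ?n"
  have "partitions_containing m \<mu> k = {\<alpha> \<in> case_nat ?n ` ?A. weight \<alpha> = m}" for m
  proof (intro subset_antisym subsetI)
    fix \<alpha> assume "\<alpha> \<in> partitions_containing m \<mu> k"
    then have \<alpha>: "is_partition \<alpha>" "weight \<alpha> = m" "\<alpha> 0 = ?n" "embeds \<mu> (width \<mu>) \<alpha> ?n"
      by (auto simp: partitions_containing_def contains_iff_embeds width_def)
    have eq: "\<alpha> = case_nat ?n (\<lambda>i. \<alpha> (Suc i))"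
      using case_nat_shift[of \<alpha>] \<alpha>(3) by simp
    then have "embeds (\<lambda>i. \<mu> (Suc i)) (width \<mu>) (\<lambda>i. \<alpha> (Suc i)) ?n"
      using \<alpha>(4) embeds_full_drop_row[of \<mu> "width \<mu>" ?n "\<lambda>i. \<alpha> (Suc i)"]
      by (simp add: width_def)
    then have "(\<lambda>i. \<alpha> (Suc i)) \<in> ?A"
      using \<alpha> is_partition_shift[OF \<alpha>(1)] is_partition_le[OF \<alpha>(1), of 0 1]
      by (simp add: embedding_partitions_def)
    then show "\<alpha> \<in> {\<alpha> \<in> case_nat ?n ` ?A. weight \<alpha> = m}" using eq \<alpha>(2) by blast
  next
    fix \<alpha> assume "\<alpha> \<in> {\<alpha> \<in> case_nat ?n ` ?A. weight \<alpha> = m}"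
    then obtain \<beta> where \<beta>: "\<alpha> = case_nat ?n \<beta>" "weight \<alpha> = m" "\<beta> \<in> ?A" by auto
    then show "\<alpha> \<in> partitions_containing m \<mu> k"
      using embeds_full_drop_row[of \<mu> "width \<mu>" ?n \<beta>]
      by (auto simp: partitions_containing_def contains_iff_embeds embedding_partitions_def
          width_def)
  qed
  then have "gen_fun \<mu> k = part_gf (case_nat ?n ` ?A)"
    by (simp add: gen_fun_def part_gf_def)
  then show ?thesis
    by (subst (asm) part_gf_case_nat) (auto simp: embedding_partitions_def)
qed

text \<open>A column has length at least 2 iff it reaches the second row, so removing the top row
  must preserve the width \<open>a\<close>.\<close>

lemma wide_partitions_columns_ge_2:
  "{lam. is_partition lam \<and> height lam \<le> Suc h \<and> width lam = a \<and>
     (\<forall>j < width lam. conj_part lam j \<ge> 2)} = case_nat a ` wide_partitions h a"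
proof -
  have "(\<forall>j<a. conj_part (case_nat a \<beta>) j \<ge> 2) \<longleftrightarrow> \<beta> 0 = a"
    if "is_partition \<beta>" "\<beta> 0 \<le> a" for \<beta>
  proof -
    have "(\<forall>j<a. conj_part (case_nat a \<beta>) j \<ge> 2) \<longleftrightarrow> (\<forall>j<a. j < \<beta> 0)"
      using that conj_part_pos_iff[OF that(1)] by (auto simp: conj_part_case_nat Suc_le_eq numeral_2_eq_2)
    also have "\<dots> \<longleftrightarrow> \<beta> 0 = a" using that by (metis le_neq_implies_less less_irrefl)
    finally show ?thesis .
  qed
  moreover have "{lam. is_partition lam \<and> height lam \<le> Suc h \<and> width lam = a \<and>
      (\<forall>j < width lam. conj_part lam j \<ge> 2)} =
      {lam \<in> wide_partitions (Suc h) a. \<forall>j<a. conj_part lam j \<ge> 2}"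
    by (auto simp: wide_partitions_def height_le_iff width_def)
  ultimately show ?thesis
    unfolding wide_partitions_Suc by (auto simp: box_partitions_def wide_partitions_def)
qed

text \<open>Group by \<open>a = width lam\<close>. The top row of \<open>lam\<close> yields
  \<open>fps_X ^ a\<close>, that of \<open>\<theta>\<close> yields \<open>fps_X ^ (k - a)\<close>;
  together they give \<open>fps_X ^ k\<close> for every \<open>a\<close>.\<close>

lemma sum_augmented_structures:
  assumes "is_partition \<mu>"
  shows "(\<Sum>(\<mu>', lam, \<theta>) \<in> augmented_structures \<mu> (Suc h) k.
      (-1) ^ width lam * fps_X ^ structure_weight (\<mu>', lam, \<theta>)) =
    fps_X ^ (weight \<mu> + k) * signed_gf h (\<lambda>i. \<mu> (Suc i)) k"
proof -
  let ?L = "\<lambda>a. case_nat a ` wide_partitions h a"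
  let ?B = "\<lambda>a. wide_partitions (Suc (h + a)) (k - a)"
  let ?f = "\<lambda>a (lam, \<theta>). (-1) ^ a *
      fps_X ^ (weight \<mu> + a * (a - 1) div 2 + col_weight lam \<mu> + weight \<theta>) :: rat fps"
  have mem: "(\<mu>', lam, \<theta>) \<in> augmented_structures \<mu> (Suc h) k \<longleftrightarrow>
      \<mu>' = \<mu> \<and> (\<exists>a\<le>k. width lam = a \<and> lam \<in> ?L a \<and> \<theta> \<in> ?B a)" for \<mu>' lam \<theta>
    unfolding wide_partitions_columns_ge_2[symmetric]
    using assms by (auto simp: augmented_structures_def wide_partitions_def height_le_iff width_def)
  \<comment> \<open>The component \<open>a\<close> is determined by \<open>lam\<close>; it is added
    to turn the sum into an iterated one.\<close>
  have aug: "augmented_structures \<mu> (Suc h) k =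
      (\<lambda>(a, lam, \<theta>). (\<mu>, lam, \<theta>)) ` (SIGMA a:{..k}. ?L a \<times> ?B a)"
  proof (rule set_eqI)
    fix x :: structure3
    obtain \<mu>' lam \<theta> where x: "x = (\<mu>', lam, \<theta>)" by (cases x)
    show "x \<in> augmented_structures \<mu> (Suc h) k \<longleftrightarrow>
        x \<in> (\<lambda>(a, lam, \<theta>). (\<mu>, lam, \<theta>)) ` (SIGMA a:{..k}. ?L a \<times> ?B a)"
      unfolding x mem image_iff by (force simp: width_def)
  qed
  have inj: "inj_on (\<lambda>(a, lam, \<theta>). (\<mu>, lam, \<theta>)) (SIGMA a:{..k}. ?L a \<times> ?B a)"
    by (auto intro!: inj_onI)
  have "(\<Sum>(\<mu>', lam, \<theta>) \<in> augmented_structures \<mu> (Suc h) k.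
      (-1) ^ width lam * fps_X ^ structure_weight (\<mu>', lam, \<theta>)) =
      (\<Sum>(a, p)\<in>(SIGMA a:{..k}. ?L a \<times> ?B a). ?f a p)"
    unfolding aug sum.reindex[OF inj]
    by (rule sum.cong) (auto simp: width_def col_weight_def ac_simps)
  also have "\<dots> = (\<Sum>a\<le>k. \<Sum>p\<in>?L a \<times> ?B a. ?f a p)"
    by (subst sum.Sigma) auto
  also have "\<dots> = (\<Sum>a\<le>k. (-1) ^ a * fps_X ^ (weight \<mu> + a * (a - 1) div 2) *
      ((\<Sum>lam\<in>?L a. fps_X ^ col_weight lam \<mu>) * (\<Sum>\<theta>\<in>?B a. fps_X ^ weight \<theta>)))"
    by (intro sum.cong refl, subst sum.cartesian_product[symmetric], subst sum_product)
      (simp add: sum_distrib_left power_add ac_simps)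
  also have "\<dots> = (\<Sum>a\<le>k. fps_X ^ (weight \<mu> + k) * ((-1) ^ a * fps_X ^ (a * (a - 1) div 2) *
      col_gf h (\<lambda>i. \<mu> (Suc i)) a * box_gf (h + a) (k - a)))"
  proof (rule sum.cong)
    fix a assume "a \<in> {..k}"
    then have k: "fps_X ^ k = (fps_X ^ a * fps_X ^ (k - a) :: rat fps)"
      by (simp flip: power_add)
    have "(\<Sum>lam\<in>?L a. fps_X ^ col_weight lam \<mu>) =
        (\<Sum>lam\<in>wide_partitions h a. fps_X ^ col_weight lam (\<lambda>c. Suc (\<mu> (Suc c))) :: rat fps)"
      by (simp add: sum.reindex inj_case_nat)
        (auto simp: wide_partitions_def col_weight_case_nat intro!: sum.cong)
    also have "\<dots> = fps_X ^ a * col_gf h (\<lambda>c. \<mu> (Suc c)) a"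
      by (rule sum_wide_col_weight_shift)
    finally show "(-1) ^ a * fps_X ^ (weight \<mu> + a * (a - 1) div 2) *
        ((\<Sum>lam\<in>?L a. fps_X ^ col_weight lam \<mu>) * (\<Sum>\<theta>\<in>?B a. fps_X ^ weight \<theta>)) =
      fps_X ^ (weight \<mu> + k) * ((-1) ^ a * fps_X ^ (a * (a - 1) div 2) *
        col_gf h (\<lambda>i. \<mu> (Suc i)) a * box_gf (h + a) (k - a))"
      by (simp only: sum_wide_partitions power_add k ac_simps)
  qed simp
  also have "\<dots> = fps_X ^ (weight \<mu> + k) * signed_gf h (\<lambda>i. \<mu> (Suc i)) k"
    by (simp only: signed_gf_def sum_distrib_left)
  finally show ?thesis .
qed

theorem theorem2p16:
  fixes \<mu> :: "nat \<Rightarrow> nat" and h k :: nat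
  assumes "h > 0" and "k > 0"
    and "is_partition \<mu>" and "\<mu> 0 > 0"
    and "h \<ge> height \<mu>"
  shows "gen_fun \<mu> k =
    1 / (\<Prod>i = 1..k + width \<mu>. 1 - fps_X ^ i) *
    (\<Sum>(\<mu>', lam, \<theta>) \<in> augmented_structures \<mu> h k.
       (-1) ^ width lam * fps_X ^ structure_weight (\<mu>', lam, \<theta>))"
proof -
  obtain h' where h: "h = Suc h'" using assms(1) by (cases h) auto
  let ?P = "\<Prod>i = 1..k + width \<mu>. 1 - fps_X ^ i :: rat fps"
  let ?\<nu> = "\<lambda>i. \<mu> (Suc i)"
  have "?P * gen_fun \<mu> k = fps_X ^ (width \<mu> + k) *
      (?P * part_gf (embedding_partitions ?\<nu> (width \<mu>) (width \<mu> + k)))"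
    using assms by (subst gen_fun_eq_part_gf) (auto simp: ac_simps)
  also have "?P * part_gf (embedding_partitions ?\<nu> (width \<mu>) (width \<mu> + k)) =
      fps_X ^ weight ?\<nu> * signed_gf h' ?\<nu> k"
    using part_gf_embedding_partitions[of ?\<nu> h' "width \<mu>" k] assms is_partition_le[OF assms(3), of 0 1]
    by (simp add: is_partition_shift height_le_iff h width_def add.commute)
  also have "fps_X ^ (width \<mu> + k) * (fps_X ^ weight ?\<nu> * signed_gf h' ?\<nu> k) =
      fps_X ^ (weight \<mu> + k) * signed_gf h' ?\<nu> k"
    using weight_shift[OF assms(3)] by (simp add: width_def power_add ac_simps)
  also have "\<dots> = (\<Sum>(\<mu>', lam, \<theta>) \<in> augmented_structures \<mu> h k.
      (-1) ^ width lam * fps_X ^ structure_weight (\<mu>', lam, \<theta>))"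
    unfolding h by (rule sum_augmented_structures[OF assms(3), symmetric])
  finally have eq: "?P * gen_fun \<mu> k = (\<Sum>(\<mu>', lam, \<theta>) \<in> augmented_structures \<mu> h k.
      (-1) ^ width lam * fps_X ^ structure_weight (\<mu>', lam, \<theta>))" .
  \<comment> \<open>Constant term 1 makes the product a unit, so the division is a genuine
    one.\<close>
  have "fps_nth (\<Prod>i = 1..n. 1 - fps_X ^ i :: rat fps) 0 = 1" for n
    by (induction n) auto
  then have "fps_nth ?P 0 = 1" .
  then have "1 / ?P * ?P = 1" by (simp add: fps_divide_unit inverse_mult_eq_1)
  then show ?thesis unfolding eq[symmetric] by (simp only: mult.assoc[symmetric]) simp
qed

end
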